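(* For every integer $n\geq 109$ with $n\equiv 0$ or $1\pmod 3$, there exists a uniquely 2-chromatic $P_4$ system of order $n$.
   Context: $P_4=(a_1,a_2,a_3,a_4)$ denotes the path on four distinct vertices with edges $\{a_1,a_2\},\{a_2,a_3\},\{a_3,a_4\}$. A $P_4$ system of order $n>1$ is a pair $(V,\mathcal B)$ where $|V|=n$ and $\mathcal B$ is a set of $P_4$ paths with vertices in $V$ whose edge sets partition the edge set of the complete graph on $V$. A $k$-colouring of $(V,\mathcal B)$ is an assignment of one of $k$ colours to each vertex of $V$ such that no path in $\mathcal B$ is monochromatic. The system is $k$-colourable if it has a $k$-colouring, and $k$-chromatic if it is $k$-colourable but not $(k-1)$-colourable. It is uniquely $2$-chromatic if it is 2-chromatic and every 2-colouring can be obtained from some fixed 2-colouring by a permutation of the two colours. *)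

theory Defs
  imports
    "HOL-Library.Ramsey"
    "HOL-Library.Disjoint_Sets"
    "HOL-Combinatorics.Permutations"
begin

text \<open>
  The tuples \<open>(a, b, c, d)\<close> and \<open>(d, c, b, a)\<close> present the same undirected path.
\<close>

type_synonym 'a p4 = "'a \<times> 'a \<times> 'a \<times> 'a"

fun p4_vertices :: "'a p4 \<Rightarrow> 'a set" where
  "p4_vertices (a, b, c, d) = {a, b, c, d}"

fun p4_edges :: "'a p4 \<Rightarrow> 'a set set" where
  "p4_edges (a, b, c, d) = {{a, b}, {b, c}, {c, d}}"

fun is_p4 :: "'a p4 \<Rightarrow> bool" where
  "is_p4 (a, b, c, d) \<longleftrightarrow> distinct [a, b, c, d]"

text \<open>
  The edges of the complete graph on \<open>V\<close> are the two-element subsets of \<open>V\<close>, \<open>nsets V 2\<close>.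
  The edge sets are required to be disjoint as a family indexed by the tuples in \<open>B\<close>
  (not merely as a set of sets), so \<open>B\<close> contains at most one of the two tuples that
  present a path. The edge sets are automatically nonempty.
\<close>

definition p4_system :: "nat \<Rightarrow> 'a set \<Rightarrow> 'a p4 set \<Rightarrow> bool" where
  "p4_system n V B \<longleftrightarrow>
     n > 1 \<and> finite V \<and> card V = n \<and>
     (\<forall>p\<in>B. is_p4 p \<and> p4_vertices p \<subseteq> V) \<and>
     disjoint_family_on p4_edges B \<and>
     (\<Union>p\<in>B. p4_edges p) = nsets V 2"

definition monochromatic :: "('a \<Rightarrow> 'c) \<Rightarrow> 'a p4 \<Rightarrow> bool" where
  "monochromatic f p \<longleftrightarrow> (\<exists>x. \<forall>v\<in>p4_vertices p. f v = x)"

text \<open>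
  The colours are \<open>0, \<dots>, k - 1\<close>; they need not all be used. Values of \<open>f\<close> outside
  \<open>V\<close> are irrelevant.
\<close>

definition colouring :: "nat \<Rightarrow> 'a set \<Rightarrow> 'a p4 set \<Rightarrow> ('a \<Rightarrow> nat) \<Rightarrow> bool" where
  "colouring k V B f \<longleftrightarrow> f ` V \<subseteq> {..<k} \<and> (\<forall>p\<in>B. \<not> monochromatic f p)"

definition colourable :: "nat \<Rightarrow> 'a set \<Rightarrow> 'a p4 set \<Rightarrow> bool" where
  "colourable k V B \<longleftrightarrow> (\<exists>f. colouring k V B f)"

definition chromatic :: "nat \<Rightarrow> 'a set \<Rightarrow> 'a p4 set \<Rightarrow> bool" where
  "chromatic k V B \<longleftrightarrow> colourable k V B \<and> \<not> colourable (k - 1) V B"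

definition uniquely_2_chromatic :: "'a set \<Rightarrow> 'a p4 set \<Rightarrow> bool" where
  "uniquely_2_chromatic V B \<longleftrightarrow>
     chromatic 2 V B \<and>
     (\<exists>f. colouring 2 V B f \<and>
        (\<forall>g. colouring 2 V B g \<longrightarrow>
           (\<exists>\<pi>. \<pi> permutes {..<2} \<and> (\<forall>v\<in>V. g v = \<pi> (f v)))))"

end

theory Submission
  imports Defs
begin

text \<open>
  A path \<open>(t, w, t', w')\<close> between old vertices \<open>t, t'\<close> and new vertices \<open>w, w'\<close> forbids
  giving \<open>w, w'\<close> both the colour \<open>x\<close> as soon as \<open>t\<close> and \<open>t'\<close> are known to have colour \<open>x\<close>.
  Hence three new vertices can be attached to a uniquely coloured system so that their
  colours are forced: if \<open>w\<^sub>1, w\<^sub>2\<close> and \<open>w\<^sub>1, w\<^sub>3\<close> are not monochromatic, and \<open>w\<^sub>2, w\<^sub>3\<close>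
  do not both have the colour \<open>x\<close>, then \<open>w\<^sub>1\<close> has colour \<open>x\<close> and \<open>w\<^sub>2, w\<^sub>3\<close> have the
  other one. The joins to all other old vertices are decomposed in groups of three, and the
  induction starts from explicit systems of orders 15 and 16.
\<close>

section \<open>Path decompositions of edge sets, and joins of vertex sets\<close>

definition decomposes :: "'a p4 set \<Rightarrow> 'a set set \<Rightarrow> bool" where
  "decomposes B E \<longleftrightarrow>
     (\<forall>p\<in>B. is_p4 p) \<and> disjoint_family_on p4_edges B \<and> (\<Union>p\<in>B. p4_edges p) = E"

definition proper :: "('a \<Rightarrow> 'c) \<Rightarrow> 'a p4 set \<Rightarrow> bool" where
  "proper f B \<longleftrightarrow> (\<forall>p\<in>B. \<not> monochromatic f p)"

definition cross :: "'a set \<Rightarrow> 'a set \<Rightarrow> 'a set set" where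
  "cross W T = (\<lambda>(w, t). {w, t}) ` (W \<times> T)"

lemma monochromatic_iff [simp]:
  "monochromatic f (a, b, c, d) \<longleftrightarrow> f a = f b \<and> f b = f c \<and> f c = f d"
  by (auto simp: monochromatic_def)

lemma proper_empty [simp]: "proper f {}"
  by (simp add: proper_def)

lemma proper_insert [simp]: "proper f (insert p B) \<longleftrightarrow> \<not> monochromatic f p \<and> proper f B"
  by (auto simp: proper_def)

lemma proper_Un [simp]: "proper f (A \<union> B) \<longleftrightarrow> proper f A \<and> proper f B"
  by (auto simp: proper_def)

lemma proper_UN [simp]: "proper f (\<Union>i\<in>I. B i) \<longleftrightarrow> (\<forall>i\<in>I. proper f (B i))"
  by (auto simp: proper_def)

lemma p4_vertices_eq_Union_edges: "p4_vertices p = \<Union>(p4_edges p)"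
  by (cases p) auto

lemma decomposes_empty: "decomposes {} {}"
  by (simp add: decomposes_def disjoint_family_on_def)

lemma decomposes_UN:
  assumes "\<And>i. i \<in> I \<Longrightarrow> decomposes (B i) (E i)" "disjoint_family_on E I"
  shows "decomposes (\<Union>i\<in>I. B i) (\<Union>i\<in>I. E i)"
proof -
  have "p4_edges p \<inter> p4_edges q = {}"
    if "i \<in> I" "j \<in> I" "p \<in> B i" "q \<in> B j" "p \<noteq> q" for i j p q
  proof (cases "i = j")
    case True
    then show ?thesis
      using that assms(1)[of i] by (auto simp: decomposes_def disjoint_family_on_def)
  next
    case False
    then have "E i \<inter> E j = {}"
      using assms(2) that by (auto simp: disjoint_family_on_def)
    moreover have "p4_edges p \<subseteq> E i" "p4_edges q \<subseteq> E j"
      using assms(1)[of i] assms(1)[of j] that by (auto simp: decomposes_def)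
    ultimately show ?thesis by blast
  qed
  then have "disjoint_family_on p4_edges (\<Union>i\<in>I. B i)"
    unfolding disjoint_family_on_def by blast
  then show ?thesis
    using assms(1) by (simp add: decomposes_def)
qed

lemma decomposes_Un:
  assumes "decomposes A E" "decomposes B F" "E \<inter> F = {}"
  shows "decomposes (A \<union> B) (E \<union> F)"
  using decomposes_UN[of UNIV "\<lambda>b. if b then A else B" "\<lambda>b. if b then E else F"] assms
  by (simp add: UNIV_bool disjoint_family_on_def Int_commute Un_commute)

lemma decomposes_insert:
  assumes "is_p4 p" "decomposes B E" "p4_edges p \<inter> E = {}"
  shows "decomposes (insert p B) (p4_edges p \<union> E)"
  using decomposes_Un[OF _ assms(2,3), of "{p}"] assms(1)
  by (simp add: decomposes_def disjoint_family_on_def)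

lemma cross_empty: "cross {} T = {}"
  by (simp add: cross_def)

lemma cross_insert: "cross (insert w W) T = (\<lambda>t. {w, t}) ` T \<union> cross W T"
  by (auto simp: cross_def)

lemma cross_UN: "cross W (\<Union>i\<in>I. T i) = (\<Union>i\<in>I. cross W (T i))"
  by (auto simp: cross_def)

lemma cross_Un: "cross W (S \<union> T) = cross W S \<union> cross W T"
  by (auto simp: cross_def)

lemma disjnt_cross: "W \<inter> S = {} \<Longrightarrow> W \<inter> T = {} \<Longrightarrow> S \<inter> T = {} \<Longrightarrow> cross W S \<inter> cross W T = {}"
  by (auto simp: cross_def doubleton_eq_iff)

lemma disjnt_nsets_cross: "V \<inter> W = {} \<Longrightarrow> nsets V 2 \<inter> cross W V = {} \<and> nsets W 2 \<inter> cross W V = {}"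
  by (auto simp: cross_def nsets_def)

lemma nsets_2_Un:
  assumes "V \<inter> W = {}"
  shows "nsets (V \<union> W) 2 = nsets V 2 \<union> nsets W 2 \<union> cross W V"
proof -
  have "{w, t} \<in> nsets (V \<union> W) 2" if "w \<in> W" "t \<in> V" for w t
    using assms that by (auto simp: nsets_def card_insert_if)
  moreover have "e \<in> nsets V 2 \<union> nsets W 2 \<union> cross W V" if "e \<in> nsets (V \<union> W) 2" for e
  proof -
    from that obtain a b where e: "e = {a, b}" "a \<noteq> b" "a \<in> V \<union> W" "b \<in> V \<union> W"
      by (auto simp: nsets_def card_2_iff)
    then show ?thesis
      by (cases "a \<in> V"; cases "b \<in> V") (auto simp: nsets_def cross_def image_iff insert_commute)
  qed
  moreover have "nsets V 2 \<union> nsets W 2 \<subseteq> nsets (V \<union> W) 2"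
    by (simp add: nsets_mono)
  ultimately show ?thesis
    by (auto simp: cross_def)
qed

lemma nsets_2_triple:
  assumes "distinct [a, b, c]"
  shows "nsets {a, b, c} 2 = {{a, b}, {b, c}, {a, c}}"
  using assms by (simp add: nsets_2_eq insert_Diff_if insert_commute)

section \<open>Explicit decompositions of small graphs\<close>

definition block :: "'a \<Rightarrow> 'a \<Rightarrow> 'a \<Rightarrow> 'a \<Rightarrow> 'a \<Rightarrow> 'a \<Rightarrow> 'a p4 set" where
  "block u v w r s t = {(r, u, s, w), (s, v, t, u), (t, w, r, v)}"

text \<open>The three paths form one orbit under rotating \<open>u, v, w\<close> and
  \<open>r, s, t\<close> simultaneously. Each pair from \<open>u, v, w\<close> thus meets exactly
  one pair from \<open>r, s, t\<close>, alternating with it on a path.\<close>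

lemma decomposes_block:
  assumes "distinct [u, v, w, r, s, t]"
  shows "decomposes (block u v w r s t) (cross {u, v, w} {r, s, t})"
proof -
  have "cross {u, v, w} {r, s, t}
      = p4_edges (r, u, s, w) \<union> (p4_edges (s, v, t, u) \<union> (p4_edges (t, w, r, v) \<union> {}))"
    using assms by (simp add: cross_empty cross_insert insert_commute)
  moreover have "decomposes {(r, u, s, w), (s, v, t, u), (t, w, r, v)} \<dots>"
    by (intro decomposes_insert decomposes_empty) (use assms in \<open>auto simp: doubleton_eq_iff\<close>)
  ultimately show ?thesis
    by (simp add: block_def)
qed

text \<open>The triangle on the new vertices is not itself a path, so it is merged with the join to
  the one old vertex left over when \<open>n mod 3 = 1\<close>; together they form K4.\<close>

definition cap1 :: "'a \<Rightarrow> 'a \<Rightarrow> 'a \<Rightarrow> 'a \<Rightarrow> 'a p4 set" where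
  "cap1 u v w t = {(u, v, w, t), (v, t, u, w)}"

lemma decomposes_cap1:
  assumes "distinct [u, v, w, t]"
  shows "decomposes (cap1 u v w t) (nsets {u, v, w} 2 \<union> cross {u, v, w} {t})"
proof -
  have "nsets {u, v, w} 2 \<union> cross {u, v, w} {t}
      = p4_edges (u, v, w, t) \<union> (p4_edges (v, t, u, w) \<union> {})"
    using assms by (simp add: cross_empty cross_insert nsets_2_triple insert_commute)
  moreover have "decomposes {(u, v, w, t), (v, t, u, w)} \<dots>"
    by (intro decomposes_insert decomposes_empty) (use assms in \<open>auto simp: doubleton_eq_iff\<close>)
  ultimately show ?thesis
    by (simp add: cap1_def)
qed

text \<open>When \<open>n mod 3 = 0\<close> no old vertex is left over, and the triangle on the new
  vertices is merged with the join to a whole old triple: K6 without the triangle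
  \<open>r, s, t\<close>.\<close>

definition cap3 :: "'a \<Rightarrow> 'a \<Rightarrow> 'a \<Rightarrow> 'a \<Rightarrow> 'a \<Rightarrow> 'a \<Rightarrow> 'a p4 set" where
  "cap3 u v w r s t = {(u, v, w, r), (r, u, w, s), (w, t, v, r), (t, u, s, v)}"

lemma decomposes_cap3:
  assumes "distinct [u, v, w, r, s, t]"
  shows "decomposes (cap3 u v w r s t) (nsets {u, v, w} 2 \<union> cross {u, v, w} {r, s, t})"
proof -
  have "nsets {u, v, w} 2 \<union> cross {u, v, w} {r, s, t}
      = p4_edges (u, v, w, r) \<union> (p4_edges (r, u, w, s) \<union> (p4_edges (w, t, v, r) \<union> (p4_edges (t, u, s, v) \<union> {})))"
    using assms by (simp add: cross_empty cross_insert nsets_2_triple insert_commute)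
  moreover have "decomposes {(u, v, w, r), (r, u, w, s), (w, t, v, r), (t, u, s, v)} \<dots>"
    by (intro decomposes_insert decomposes_empty) (use assms in \<open>auto simp: doubleton_eq_iff\<close>)
  ultimately show ?thesis
    by (simp add: cap3_def)
qed

text \<open>Covering follows by counting: distinct edges of the complete graph, as many as it has,
  are all of them. For a concrete list only distinctness and the length remain to be
  computed.\<close>

lemma decomposes_list:
  fixes ps :: "'a p4 list"
  assumes "finite V" and "\<forall>p\<in>set ps. is_p4 p \<and> p4_vertices p \<subseteq> V"
    and "distinct (concat (map (\<lambda>(a, b, c, d). [{a, b}, {b, c}, {c, d}]) ps))"
    and "3 * length ps = card V choose 2"
  shows "decomposes (set ps) (nsets V 2)"
proof -
  define es :: "'a p4 \<Rightarrow> 'a set list" where "es = (\<lambda>(a, b, c, d). [{a, b}, {b, c}, {c, d}])"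
  have set_es: "set (es p) = p4_edges p" for p
    by (cases p) (simp add: es_def)
  have len_es: "length (es p) = 3" for p
    by (cases p) (simp add: es_def)
  have dist: "distinct (concat (map es ps))"
    using assms(3) by (simp add: es_def)
  have "disjoint_family_on p4_edges (set ps)"
    using dist set_es len_es
  proof (induction ps)
    case (Cons p ps)
    then have "set (es p) \<inter> (\<Union>q\<in>set ps. p4_edges q) = {}"
      by auto
    then show ?case
      using Cons by (auto simp: disjoint_family_on_def)
  qed (simp add: disjoint_family_on_def)
  moreover have "(\<Union>p\<in>set ps. p4_edges p) = nsets V 2"
  proof (rule card_subset_eq)
    show "finite (nsets V 2)"
      using assms(1) by (simp add: finite_imp_finite_nsets)
    show "(\<Union>p\<in>set ps. p4_edges p) \<subseteq> nsets V 2"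
      using assms(2) by (fastforce simp: nsets_2_eq)
    have "card (set (concat (map es ps))) = length (concat (map es ps))"
      using dist by (rule distinct_card)
    also have "\<dots> = 3 * length ps"
      by (simp add: length_concat comp_def len_es sum_list_triv)
    finally show "card (\<Union>p\<in>set ps. p4_edges p) = card (nsets V 2)"
      using assms(4) by (simp add: set_es card_nsets)
  qed
  ultimately show ?thesis
    using assms(2) by (simp add: decomposes_def)
qed

section \<open>The colour pattern and the systems of orders 15 and 16\<close>

text \<open>
  With \<open>x\<close> for \<open>True\<close> and \<open>y\<close> for \<open>False\<close>, the vertices \<open>3j, 3j + 1, 3j + 2\<close> have the
  colours \<open>x, y, y\<close>, except for \<open>6, 7, 8\<close>, which all have colour \<open>x\<close>.
\<close>

definition col :: "nat \<Rightarrow> bool" where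
  "col v \<longleftrightarrow> 3 dvd v \<or> v = 7 \<or> v = 8"

text \<open>Since \<open>col 0\<close> holds, the last clause says that \<open>g\<close> is
  \<open>col\<close> or its complement, according to \<open>g 0\<close>. As \<open>col\<close> does
  not depend on \<open>n\<close>, the colours of the vertices 0 to 8 are known at every stage of the
  induction.\<close>

definition rigid :: "nat \<Rightarrow> nat p4 set \<Rightarrow> bool" where
  "rigid n B \<longleftrightarrow> decomposes B (nsets {..<n} 2) \<and> proper col B \<and>
     (\<forall>g :: nat \<Rightarrow> bool. proper g B \<longrightarrow> (\<forall>v<n. g v \<longleftrightarrow> (g 0 \<longleftrightarrow> col v)))"

text \<open>
  Found by simulated annealing over the decompositions of the complete graph, minimising the
  number of proper colourings other than \<open>col\<close> and its complement.
\<close>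

definition base15 :: "nat p4 list" where
  "base15 = [
    (0, 5, 14, 7), (0, 6, 2, 1), (0, 8, 1, 9), (0, 11, 5, 8), (1, 0, 13, 2),
    (1, 3, 4, 11), (1, 4, 10, 8), (1, 6, 13, 11), (1, 12, 14, 9), (1, 13, 12, 6),
    (1, 14, 3, 9), (2, 4, 9, 5), (2, 5, 4, 6), (2, 7, 11, 10), (2, 9, 12, 8),
    (2, 14, 6, 10), (3, 0, 9, 10), (3, 2, 8, 7), (3, 6, 5, 12), (3, 10, 13, 14),
    (3, 12, 2, 10), (3, 13, 7, 6), (4, 0, 7, 12), (4, 12, 0, 10), (5, 3, 11, 9),
    (6, 8, 4, 14), (6, 9, 7, 10), (6, 11, 8, 9), (7, 1, 11, 12), (7, 3, 8, 14),
    (7, 4, 13, 9), (7, 5, 1, 10), (8, 13, 5, 10), (11, 2, 0, 14), (11, 14, 10, 12)]"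

definition base16 :: "nat p4 list" where
  "base16 = [
    (0, 2, 3, 6), (0, 8, 13, 6), (0, 10, 13, 1), (0, 12, 15, 14), (0, 15, 7, 4),
    (1, 0, 4, 8), (1, 2, 11, 15), (1, 3, 8, 6), (1, 5, 12, 6), (1, 6, 7, 10),
    (1, 7, 14, 13), (1, 10, 3, 7), (1, 11, 3, 4), (2, 8, 12, 10), (2, 9, 0, 3),
    (2, 14, 11, 7), (3, 13, 7, 8), (3, 14, 6, 4), (4, 1, 14, 12), (4, 2, 10, 9),
    (4, 5, 0, 7), (4, 9, 8, 10), (4, 13, 15, 6), (4, 15, 5, 7), (5, 3, 9, 12),
    (5, 11, 0, 14), (5, 13, 2, 15), (6, 0, 13, 11), (6, 2, 7, 12), (6, 9, 1, 15),
    (6, 10, 4, 14), (7, 9, 11, 12), (8, 5, 2, 12), (8, 14, 10, 11), (8, 15, 9, 14),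
    (10, 5, 6, 11), (10, 15, 3, 12), (11, 4, 12, 13), (11, 8, 1, 12), (13, 9, 5, 14)]"

lemma rigid_base15: "rigid 15 (set base15)"
  unfolding rigid_def
proof (intro conjI allI impI)
  show "decomposes (set base15) (nsets {..<15} 2)"
  proof (rule decomposes_list)
    show "3 * length base15 = card {..<15::nat} choose 2"
      by (simp add: base15_def choose_two)
  qed (simp_all add: base15_def doubleton_eq_iff)
  show "proper col (set base15)"
    by (simp add: base15_def col_def)
  fix g :: "nat \<Rightarrow> bool" and v :: nat
  assume g: "proper g (set base15)" and "v < 15"
  \<comment> \<open>Each path is a not-all-equal constraint on four Booleans, so this is a finite
    propositional problem.\<close>
  have "g 1 \<noteq> g 0 \<and> g 2 \<noteq> g 0 \<and> g 3 = g 0 \<and> g 4 \<noteq> g 0 \<and> g 5 \<noteq> g 0 \<and> g 6 = g 0 \<and> g 7 = g 0 \<and> g 8 = g 0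
    \<and> g 9 = g 0 \<and> g 10 \<noteq> g 0 \<and> g 11 \<noteq> g 0 \<and> g 12 = g 0 \<and> g 13 \<noteq> g 0 \<and> g 14 \<noteq> g 0"
    using g unfolding base15_def list.set proper_insert monochromatic_iff by (smt (verit))
  then have "\<forall>v\<in>{..<15}. g v \<longleftrightarrow> (g 0 \<longleftrightarrow> col v)"
    by (auto simp: lessThan_nat_numeral col_def)
  then show "g v \<longleftrightarrow> (g 0 \<longleftrightarrow> col v)"
    using \<open>v < 15\<close> by blast
qed

lemma rigid_base16: "rigid 16 (set base16)"
  unfolding rigid_def
proof (intro conjI allI impI)
  show "decomposes (set base16) (nsets {..<16} 2)"
  proof (rule decomposes_list)
    show "3 * length base16 = card {..<16::nat} choose 2"
      by (simp add: base16_def choose_two)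
  qed (simp_all add: base16_def doubleton_eq_iff)
  show "proper col (set base16)"
    by (simp add: base16_def col_def)
  fix g :: "nat \<Rightarrow> bool" and v :: nat
  assume g: "proper g (set base16)" and "v < 16"
  have "g 1 \<noteq> g 0 \<and> g 2 \<noteq> g 0 \<and> g 3 = g 0 \<and> g 4 \<noteq> g 0 \<and> g 5 \<noteq> g 0 \<and> g 6 = g 0 \<and> g 7 = g 0 \<and> g 8 = g 0
    \<and> g 9 = g 0 \<and> g 10 \<noteq> g 0 \<and> g 11 \<noteq> g 0 \<and> g 12 = g 0 \<and> g 13 \<noteq> g 0 \<and> g 14 \<noteq> g 0 \<and> g 15 = g 0"
    using g unfolding base16_def list.set proper_insert monochromatic_iff by (smt (verit))
  then have "\<forall>v\<in>{..<16}. g v \<longleftrightarrow> (g 0 \<longleftrightarrow> col v)"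
    by (auto simp: lessThan_nat_numeral col_def)
  then show "g v \<longleftrightarrow> (g 0 \<longleftrightarrow> col v)"
    using \<open>v < 16\<close> by blast
qed

section \<open>Attaching three new vertices\<close>

text \<open>
  The old vertices of the block \<open>j = 0\<close> are rotated: so the pair \<open>y, y\<close> is joined to \<open>u\<close> and
  \<open>w\<close> in block \<open>0\<close>, and to \<open>v\<close> and \<open>u\<close> in block \<open>1\<close>.
\<close>

definition triple_block :: "nat \<Rightarrow> nat \<Rightarrow> nat \<Rightarrow> nat \<Rightarrow> nat p4 set" where
  "triple_block u v w j =
     (if j = 0 then block u v w 1 2 0 else block u v w (3 * j) (3 * j + 1) (3 * j + 2))"

lemma decomposes_triple_block:
  assumes "distinct [u, v, w]" "{u, v, w} \<inter> {..<3 * j + 3} = {}"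
  shows "decomposes (triple_block u v w j) (cross {u, v, w} {3 * j..<3 * j + 3})"
proof (cases "j = 0")
  case True
  have "{0..<3::nat} = {1, 2, 0}"
    by auto
  then show ?thesis
    using True assms decomposes_block[of u v w 1 2 0] by (auto simp: triple_block_def)
next
  case False
  have "{3 * j..<3 * j + 3} = {3 * j, 3 * j + 1, 3 * j + 2}"
    by auto
  then show ?thesis
    using False assms decomposes_block[of u v w "3 * j" "3 * j + 1" "3 * j + 2"]
    by (auto simp: triple_block_def)
qed

text \<open>The first two paths of a block contain \<open>u\<close> and one of \<open>v, w\<close>,
  which differ in colour. The third contains \<open>v, w\<close> and an old vertex divisible by 3,
  which has colour x.\<close>

lemma col_triple_block:
  assumes "col u" "\<not> col v" "\<not> col w"
  shows "proper col (triple_block u v w j)"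
proof -
  have "col (3 * j)" "col 0"
    by (auto simp: col_def)
  then show ?thesis
    using assms by (auto simp: triple_block_def block_def)
qed

text \<open>Let x be the colour of vertex 0. Block 2 has old vertices 6, 7, 8, all of colour x, so
  at most one of \<open>u, v, w\<close> has colour x. If \<open>u\<close> had colour y, block 0
  would give \<open>w\<close> and block 1 would give \<open>v\<close> the colour x, a contradiction.
  So \<open>u\<close> has colour x and the others y.\<close>

lemma triple_blocks_force:
  assumes g: "proper g (triple_block u v w 0)" "proper g (triple_block u v w 1)"
      "proper g (triple_block u v w 2)"
    and old: "\<And>t. t < 9 \<Longrightarrow> g t \<longleftrightarrow> (g 0 \<longleftrightarrow> col t)"
  shows "g u \<longleftrightarrow> g 0" "g v \<longleftrightarrow> \<not> g 0" "g w \<longleftrightarrow> \<not> g 0"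
proof -
  have "g 1 = (\<not> g 0)" "g 2 = (\<not> g 0)" "g 3 = g 0" "g 4 = (\<not> g 0)" "g 5 = (\<not> g 0)"
      "g 6 = g 0" "g 7 = g 0" "g 8 = g 0"
    using old[of 1] old[of 2] old[of 3] old[of 4] old[of 5] old[of 6] old[of 7] old[of 8]
    by (auto simp: col_def)
  then show "g u \<longleftrightarrow> g 0" "g v \<longleftrightarrow> \<not> g 0" "g w \<longleftrightarrow> \<not> g 0"
    using g unfolding triple_block_def block_def by (simp_all; argo)+
qed

text \<open>The blocks \<open>j < m\<close> cover the first \<open>3 * m\<close> old vertices and,
  as \<open>m\<close> is at least 3, already force the new colours; the cap \<open>S\<close> only
  has to respect \<open>col\<close>. The order of the new vertices is left open because
  \<open>u\<close> must be the one divisible by 3.\<close>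

lemma rigid_extend:
  assumes B: "rigid n B" and m: "3 \<le> m" "3 * m \<le> n"
    and W: "{u, v, w} = {n..<n + 3}" "distinct [u, v, w]"
    and c: "col u" "\<not> col v" "\<not> col w"
    and S: "decomposes S (nsets {u, v, w} 2 \<union> cross {u, v, w} {3 * m..<n})" "proper col S"
  shows "rigid (n + 3) (B \<union> (\<Union>j<m. triple_block u v w j) \<union> S)"
proof -
  let ?W = "{u, v, w}" and ?T = "\<Union>j<m. triple_block u v w j"
  have W_disj: "?W \<inter> {..<n} = {}"
    using W(1) by auto
  have "decomposes ?T (\<Union>j<m. cross ?W {3 * j..<3 * j + 3})"
  proof (rule decomposes_UN)
    show "decomposes (triple_block u v w j) (cross ?W {3 * j..<3 * j + 3})" if "j \<in> {..<m}" for j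
    proof (rule decomposes_triple_block[OF W(2)])
      have "3 * j + 3 \<le> n"
        using that m by auto
      then show "?W \<inter> {..<3 * j + 3} = {}"
        using W(1) by auto
    qed
    show "disjoint_family_on (\<lambda>j. cross ?W {3 * j..<3 * j + 3}) {..<m}"
      unfolding disjoint_family_on_def
    proof (intro ballI impI disjnt_cross)
      fix i j :: nat
      assume ij: "i \<in> {..<m}" "j \<in> {..<m}" "i \<noteq> j"
      show "{3 * i..<3 * i + 3} \<inter> {3 * j..<3 * j + 3} = {}"
        using ij by auto
      have "3 * i + 3 \<le> n" "3 * j + 3 \<le> n"
        using ij m by auto
      then show "?W \<inter> {3 * i..<3 * i + 3} = {}" "?W \<inter> {3 * j..<3 * j + 3} = {}"
        unfolding W(1) by auto
    qed
  qed
  also have "(\<Union>j<m. cross ?W {3 * j..<3 * j + 3}) = cross ?W {..<3 * m}"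
  proof -
    have "t \<in> (\<Union>j<m. {3 * j..<3 * j + 3})" if "t < 3 * m" for t
      by (rule UN_I[of "t div 3"]) (use that in auto)
    then have "{..<3 * m} = (\<Union>j<m. {3 * j..<3 * j + 3})"
      by auto
    then show ?thesis
      by (simp only: cross_UN)
  qed
  finally have T: "decomposes ?T (cross ?W {..<3 * m})" .
  have split: "{..<n} = {..<3 * m} \<union> {3 * m..<n}"
    using m by auto
  have whole: "nsets {..<n + 3} 2
      = nsets {..<n} 2 \<union> cross ?W {..<3 * m} \<union> (nsets ?W 2 \<union> cross ?W {3 * m..<n})"
  proof -
    have "{..<n + 3} = {..<n} \<union> ?W"
      unfolding W(1) by auto
    then show ?thesis
      using nsets_2_Un[of "{..<n}" ?W] W_disj cross_Un[of ?W "{..<3 * m}" "{3 * m..<n}"]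
      by (simp add: split[symmetric] Un_ac Int_commute)
  qed
  have cross_le: "cross ?W {..<n} = cross ?W {..<3 * m} \<union> cross ?W {3 * m..<n}"
    by (simp only: split cross_Un)
  have "nsets {..<n} 2 \<inter> nsets ?W 2 = {}"
    using W_disj by (fastforce simp: nsets_2_eq)
  moreover have "cross ?W {..<3 * m} \<inter> cross ?W {3 * m..<n} = {}"
    by (rule disjnt_cross) (use W(1) m in auto)
  ultimately have dec: "decomposes (B \<union> ?T \<union> S) (nsets {..<n + 3} 2)"
    unfolding whole
    using B S(1) T disjnt_nsets_cross[of "{..<n}" ?W] W_disj cross_le
    by (intro decomposes_Un) (auto simp: rigid_def)
  have "g t \<longleftrightarrow> (g 0 \<longleftrightarrow> col t)" if g: "proper g (B \<union> ?T \<union> S)" and t: "t < n + 3" for g t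
  proof -
    have old: "g s \<longleftrightarrow> (g 0 \<longleftrightarrow> col s)" if "s < n" for s
      using B g that by (auto simp: rigid_def)
    have "proper g (triple_block u v w j)" if "j < m" for j
      using g that by simp
    then have blocks: "proper g (triple_block u v w 0)" "proper g (triple_block u v w 1)"
        "proper g (triple_block u v w 2)"
      using m by simp_all
    \<comment> \<open>Here \<open>9 \<le> 3 * m \<le> n\<close>, so the vertices of the three
      forcing blocks are all old.\<close>
    have "g s \<longleftrightarrow> (g 0 \<longleftrightarrow> col s)" if "s < 9" for s
      using old[of s] that m by simp
    note new = triple_blocks_force[OF blocks this]
    have "t < n \<or> t = u \<or> t = v \<or> t = w"
      using t W(1) by (metis atLeastLessThan_iff insertE not_less singletonD)
    then show ?thesis
      using old new c by auto
  qed
  then show ?thesis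
    using dec B S(2) col_triple_block[OF c] by (auto simp: rigid_def)
qed

lemma rigid_step:
  assumes B: "rigid n B" and n: "n \<ge> 15" "n mod 3 = 0 \<or> n mod 3 = 1"
  shows "\<exists>B'. rigid (n + 3) B'"
  using n(2)
proof
  assume "n mod 3 = 0"
  \<comment> \<open>The last old triple is kept back for the cap.\<close>
  define k where "k = n div 3 - 1"
  have k: "n = 3 * k + 3" "k \<ge> 4"
    using n(1) \<open>n mod 3 = 0\<close> unfolding k_def by presburger+
  let ?S = "cap3 n (n + 1) (n + 2) (3 * k) (3 * k + 1) (3 * k + 2)"
  have "rigid (n + 3) (B \<union> (\<Union>j<k. triple_block n (n + 1) (n + 2) j) \<union> ?S)"
  proof (rule rigid_extend[OF B])
    show c: "col n" "\<not> col (n + 1)" "\<not> col (n + 2)"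
      unfolding col_def using k by presburger+
    have "{3 * k..<n} = {3 * k, 3 * k + 1, 3 * k + 2}"
      using k by auto
    then show "decomposes ?S (nsets {n, n + 1, n + 2} 2 \<union> cross {n, n + 1, n + 2} {3 * k..<n})"
      using decomposes_cap3[of n "n + 1" "n + 2" "3 * k" "3 * k + 1" "3 * k + 2"] k by simp
    \<comment> \<open>Only the path \<open>(w, t, v, r)\<close> of the cap avoids \<open>u\<close>;
      its end \<open>r = 3 * k\<close> has colour x, unlike \<open>v\<close> and
      \<open>w\<close>.\<close>
    have "col (3 * k)"
      by (simp add: col_def)
    then show "proper col ?S"
      using c by (simp add: cap3_def)
  qed (use k in auto)
  then show ?thesis ..
next
  assume "n mod 3 = 1"
  define k where "k = n div 3"
  have k: "n = 3 * k + 1" "k \<ge> 4"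
    using n(1) \<open>n mod 3 = 1\<close> unfolding k_def by presburger+
  \<comment> \<open>Now \<open>n + 2\<close> is the new multiple of 3, so it takes the role of
    \<open>u\<close>.\<close>
  let ?S = "cap1 (n + 2) n (n + 1) (3 * k)"
  have "rigid (n + 3) (B \<union> (\<Union>j<k. triple_block (n + 2) n (n + 1) j) \<union> ?S)"
  proof (rule rigid_extend[OF B])
    show c: "col (n + 2)" "\<not> col n" "\<not> col (n + 1)"
      unfolding col_def using k by presburger+
    have "{3 * k..<n} = {3 * k}"
      using k by auto
    then show "decomposes ?S (nsets {n + 2, n, n + 1} 2 \<union> cross {n + 2, n, n + 1} {3 * k..<n})"
      using decomposes_cap1[of "n + 2" n "n + 1" "3 * k"] k by simp
    show "proper col ?S"
      using c by (simp add: cap1_def)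
  qed (use k in auto)
  then show ?thesis ..
qed

lemma rigid_exists:
  assumes "n \<ge> 15" "n mod 3 = 0 \<or> n mod 3 = 1"
  shows "\<exists>B. rigid n B"
  using assms
proof (induction n rule: less_induct)
  case (less n)
  \<comment> \<open>17 has the wrong residue, so every other \<open>n\<close> leaves
    \<open>n - 3 \<ge> 15\<close>.\<close>
  then have "n = 15 \<or> n = 16 \<or> n \<ge> 18"
    by presburger
  then consider "n = 15" | "n = 16" | "n \<ge> 18"
    by blast
  then show ?case
  proof cases
    case 3
    define k where "k = n - 3"
    have k: "n = k + 3" "k \<ge> 15"
      using 3 by (simp_all add: k_def)
    then show ?thesis
      using less.IH[of k] less.prems(2) rigid_step[of k] by auto
  qed (use rigid_base15 rigid_base16 in auto)
qed

section \<open>From rigid decompositions to uniquely 2-chromatic systems\<close>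

lemma rigid_imp_p4_system:
  assumes B: "rigid n B" and n: "n > 1"
  shows "p4_system n {..<n} B"
proof -
  have dec: "decomposes B (nsets {..<n} 2)"
    using B by (simp add: rigid_def)
  have "p4_vertices p \<subseteq> {..<n}" if "p \<in> B" for p
  proof -
    have "p4_edges p \<subseteq> nsets {..<n} 2"
      using dec that by (auto simp: decomposes_def)
    then show ?thesis
      unfolding p4_vertices_eq_Union_edges by (auto simp: nsets_def)
  qed
  then show ?thesis
    using n dec by (simp add: p4_system_def decomposes_def)
qed

lemma rigid_imp_uniquely_2_chromatic:
  assumes B: "rigid n B" and n: "n > 1"
  shows "uniquely_2_chromatic {..<n} B"
proof -
  let ?f = "\<lambda>v. of_bool (col v) :: nat"
  have p4s: "p4_system n {..<n} B"
    using assms by (rule rigid_imp_p4_system)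
  have "monochromatic ?f p \<longleftrightarrow> monochromatic col p" for p
    by (cases p) (simp add: of_bool_eq_iff)
  then have f: "colouring 2 {..<n} B ?f"
    using B by (simp add: colouring_def rigid_def proper_def image_subset_iff)
  have "\<not> colourable 1 {..<n} B"
  proof
    assume "colourable 1 {..<n} B"
    then obtain h where h: "\<And>v. v < n \<Longrightarrow> h v = (0::nat)" "\<And>p. p \<in> B \<Longrightarrow> \<not> monochromatic h p"
      by (auto simp: colourable_def colouring_def)
    \<comment> \<open>One colour fails as soon as there is a path at all; the edge
      \<open>{0, 1}\<close> lies on one.\<close>
    have "{0, 1} \<in> (\<Union>p\<in>B. p4_edges p)"
      using p4s n by (simp add: p4_system_def)
    then obtain p where p: "p \<in> B"
      by blast
    then have "v < n" if "v \<in> p4_vertices p" for v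
      using p4s that by (auto simp: p4_system_def)
    then have "monochromatic h p"
      unfolding monochromatic_def using h(1) by blast
    then show False
      using h(2) p by blast
  qed
  moreover have "\<exists>\<pi>. \<pi> permutes {..<2} \<and> (\<forall>v\<in>{..<n}. g v = \<pi> (?f v))"
    if g: "colouring 2 {..<n} B g" for g
  proof -
    have two: "g v = 0 \<or> g v = 1" if "v < n" for v
    proof -
      have "g v < 2"
        using g that by (auto simp: colouring_def image_subset_iff)
      then show ?thesis
        by auto
    qed
    \<comment> \<open>Passing to Booleans loses nothing, because \<open>g\<close> takes only the
      values 0 and 1 on the vertices of the paths.\<close>
    have "proper (\<lambda>v. g v = 1) B"
      unfolding proper_def
    proof (intro ballI notI)
      fix p assume p: "p \<in> B" and "monochromatic (\<lambda>v. g v = 1) p"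
      then obtain x where x: "\<And>v. v \<in> p4_vertices p \<Longrightarrow> (g v = 1) = x"
        unfolding monochromatic_def by blast
      have "g v = of_bool x" if "v \<in> p4_vertices p" for v
      proof -
        have "v < n"
          using p4s p that by (auto simp: p4_system_def)
        then show ?thesis
          using two[of v] x[OF that] by (cases x) auto
      qed
      then have "monochromatic g p"
        unfolding monochromatic_def by blast
      then show False
        using g p by (simp add: colouring_def)
    qed
    then have eq: "g v = 1 \<longleftrightarrow> (g 0 = 1 \<longleftrightarrow> col v)" if "v < n" for v
      using B that unfolding rigid_def by blast
    show ?thesis
    \<comment> \<open>As \<open>?f 0 = 1\<close>, the value \<open>g 0\<close> decides between the
      identity and the swap of colours.\<close>
    proof (cases "g 0 = 1")
      case True
      have "g v = id (?f v)" if "v < n" for v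
        using eq[OF that] two[OF that] True by (cases "col v") auto
      then show ?thesis
        by (intro exI[of _ id]) (simp add: permutes_id)
    next
      case False
      have "g v = transpose 0 1 (?f v)" if "v < n" for v
        using eq[OF that] two[OF that] False by (cases "col v") auto
      moreover have "transpose 0 1 permutes {..<2::nat}"
        by (rule permutes_swap_id) auto
      ultimately show ?thesis
        by (intro exI[of _ "transpose 0 1"]) simp
    qed
  qed
  ultimately show ?thesis
    using f by (auto simp: uniquely_2_chromatic_def chromatic_def colourable_def)
qed

theorem theorem4p12:
  fixes n :: nat
  assumes "n \<ge> 109" and "n mod 3 = 0 \<or> n mod 3 = 1"
  shows "\<exists>(V :: nat set) (B :: nat p4 set). p4_system n V B \<and> uniquely_2_chromatic V B"
proof -
  obtain B where "rigid n B"
    using rigid_exists assms by fastforce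
  then show ?thesis
    using assms(1) rigid_imp_p4_system rigid_imp_uniquely_2_chromatic by fastforce
qed

end
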